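(* Let $X$ be a locally compact and separable metric space with Borel $\sigma$-algebra $\mathcal{B}$, and let $\mu : \mathcal{B} \to [0,\infty]$ be a Borel measure such that $\mu(O) > 0$ for all non-empty open sets $O \subset X$ and $\mu(K) < \infty$ for all compact sets $K \subset X$. Assume that $V$ is a reflexive Banach space that embeds (continuously and) densely into $L^1(X,\mu)$ and continuously into the space $C_b(X)$ of bounded continuous functions. Let $$M := \{ v \in L^\infty(X,\mu) \mid -1 \le v \le 1 \ \mu\text{-a.e. in } X \},$$ considered as a subset of the dual space $V^\star$. Suppose that a tuple $(q,y) \in M \times V$ is given such that $y \in \mathcal{N}_M(q) \subset V^{\star\star} \cong V$ and such that there exists an open set $O \subset X$ with $\mu(O \cap \{y = 0\}) = 0$ and $O \cap \{y = 0\} \neq \emptyset$. Further, suppose that for every $x \in O$ there is a function $\varphi \in V$ with $\varphi(x) = 1$ and $\varphi = 0$ on $X \setminus O$. Then $M$ is not polyhedric at $q$ with respect to $y$.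
   Context: All function spaces are real. Elements of $V$ are functions on $X$ and the continuous representatives of $y$ and $\varphi$ are used to define $\{y=0\}$ and pointwise values. Identification: since $V$ is continuously and densely embedded into $L^1(X,\mu)$, each $v \in L^\infty(X,\mu)$ is identified with the functional $u \mapsto \int_X v\,u\,\mathrm{d}\mu$ in $V^\star$. The set $M$ is convex, non-empty and closed in $V^\star$. Polyhedricity: for a closed, convex, non-empty subset $K$ of a Banach space $W$ and $w \in K$, let $\mathcal{R}_K(w) := \mathbb{R}^+(K - w)$, $\mathcal{T}_K(w) := \overline{\mathcal{R}_K(w)}$ (closure in $W$) and $\mathcal{N}_K(w) := \mathcal{T}_K(w)^\circ = \{\eta \in W^\star \mid \langle \eta, h\rangle \le 0 \ \forall h \in \mathcal{T}_K(w)\}$ be the radial, tangent and normal cone. For $\eta \in W^\star$ let $\eta^\perp \subset W$ denote the kernel of $\eta$. $K$ is polyhedric at $w \in K$ with respect to $\eta \in \mathcal{N}_K(w)$ if $\mathcal{T}_K(w) \cap \eta^\perp = \overline{\mathcal{R}_K(w) \cap \eta^\perp}$. Here this is applied with $W = V^\star$ and $W^\star = V^{\star\star} \cong V$. *)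

theory Defs
  imports "HOL-Analysis.Analysis"
begin

lift_definition bidual_embedding ::
    "'v::real_normed_vector \<Rightarrow> ('v \<Rightarrow>\<^sub>L real) \<Rightarrow>\<^sub>L real"
  is "\<lambda>v f. blinfun_apply f v"
  by (rule bounded_bilinear.bounded_linear_left[OF bounded_bilinear_blinfun_apply])

lemma bidual_embedding_apply [simp]: "blinfun_apply (bidual_embedding v) f = blinfun_apply f v"
  by transfer simp

definition reflexive_space :: "'v::banach itself \<Rightarrow> bool" where
  "reflexive_space _ \<longleftrightarrow>
     surj (bidual_embedding :: 'v \<Rightarrow> ('v \<Rightarrow>\<^sub>L real) \<Rightarrow>\<^sub>L real)"

definition radial_cone :: "'w::real_normed_vector set \<Rightarrow> 'w \<Rightarrow> 'w set" where
  "radial_cone K w = {t *\<^sub>R (k - w) | t k. t > 0 \<and> k \<in> K}"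

definition tangent_cone :: "'w::real_normed_vector set \<Rightarrow> 'w \<Rightarrow> 'w set" where
  "tangent_cone K w = closure (radial_cone K w)"

definition normal_cone :: "'w::real_normed_vector set \<Rightarrow> 'w \<Rightarrow> ('w \<Rightarrow>\<^sub>L real) set" where
  "normal_cone K w = {\<eta>. \<forall>h\<in>tangent_cone K w. blinfun_apply \<eta> h \<le> 0}"

definition annihilator :: "('w::real_normed_vector \<Rightarrow>\<^sub>L real) \<Rightarrow> 'w set" where
  "annihilator \<eta> = {h. blinfun_apply \<eta> h = 0}"

(* Only the defining equation.  The requirements that K be closed, convex and non-empty, that
   w \<in> K and that \<eta> \<in> normal_cone K w are deliberately not conjuncts, so that the
   negation of polyhedric_at can never hold merely because one of them fails. *)
definition polyhedric_at ::
    "'w::real_normed_vector set \<Rightarrow> 'w \<Rightarrow> ('w \<Rightarrow>\<^sub>L real) \<Rightarrow> bool" where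
  "polyhedric_at K w \<eta> \<longleftrightarrow>
     tangent_cone K w \<inter> annihilator \<eta> = closure (radial_cone K w \<inter> annihilator \<eta>)"

(* A space V of functions on X is an abstract Banach space 'v together with a map J sending an
   element of V to its continuous representative.  Elements of L^1 and L^infinity are represented
   by measurable functions, equality in these spaces being equality almost everywhere. *)

definition embeds_Cb :: "('v::real_normed_vector \<Rightarrow> ('x::topological_space \<Rightarrow>\<^sub>C real)) \<Rightarrow> bool" where
  "embeds_Cb J \<longleftrightarrow> bounded_linear J \<and> inj J"

definition embeds_densely_L1 ::
    "'x::topological_space measure \<Rightarrow> ('v::real_normed_vector \<Rightarrow> ('x \<Rightarrow>\<^sub>C real)) \<Rightarrow> bool" where
  "embeds_densely_L1 \<mu> J \<longleftrightarrow>
     linear J \<and>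
     (\<forall>u. integrable \<mu> (apply_bcontfun (J u))) \<and>
     (\<exists>C. \<forall>u. (\<integral>x. \<bar>apply_bcontfun (J u) x\<bar> \<partial>\<mu>) \<le> C * norm u) \<and>
     (\<forall>u v. (AE x in \<mu>. apply_bcontfun (J u) x = apply_bcontfun (J v) x) \<longrightarrow> u = v) \<and>
     (\<forall>f :: 'x \<Rightarrow> real. integrable \<mu> f \<longrightarrow>
        (\<forall>\<epsilon>>0. \<exists>u. (\<integral>x. \<bar>f x - apply_bcontfun (J u) x\<bar> \<partial>\<mu>) < \<epsilon>))"

definition Linfty :: "'x measure \<Rightarrow> ('x \<Rightarrow> real) set" where
  "Linfty \<mu> = {v \<in> borel_measurable \<mu>. \<exists>C. AE x in \<mu>. \<bar>v x\<bar> \<le> C}"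

definition represents ::
    "'x::topological_space measure \<Rightarrow> ('v::real_normed_vector \<Rightarrow> ('x \<Rightarrow>\<^sub>C real)) \<Rightarrow>
     ('x \<Rightarrow> real) \<Rightarrow> ('v \<Rightarrow>\<^sub>L real) \<Rightarrow> bool" where
  "represents \<mu> J v \<eta> \<longleftrightarrow>
     (\<forall>u. blinfun_apply \<eta> u = (\<integral>x. v x * apply_bcontfun (J u) x \<partial>\<mu>))"

(* The set {v \<in> L^infinity. -1 \<le> v \<le> 1 a.e.} as a subset of the dual of V, under the
   identification of v with the functional mapping u to the integral of v u. *)
definition box_set ::
    "'x::topological_space measure \<Rightarrow> ('v::real_normed_vector \<Rightarrow> ('x \<Rightarrow>\<^sub>C real)) \<Rightarrow>
     ('v \<Rightarrow>\<^sub>L real) set" where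
  "box_set \<mu> J =
     {\<eta>. \<exists>v\<in>Linfty \<mu>. (AE x in \<mu>. -1 \<le> v x \<and> v x \<le> 1) \<and> represents \<mu> J v \<eta>}"

end

theory Submission
  imports Defs
begin

text \<open>Pick $x_0 \in O$ with $y(x_0) = 0$. Every direction in $\mathcal{R}_M(q) \cap y^\perp$ vanishes
  a.e. on $\{y \neq 0\}$, hence a.e. on $O$, so it annihilates each $\varphi \in V$ that vanishes
  outside $O$, and this passes to the closure. On the other hand $x_0$ is a limit of points with
  $s y > 0$ for some sign $s$, near which $q = s$; the functional $-s \delta_{x_0}$ belongs to
  $\mathcal{T}_M(q)$, since otherwise Hahn--Banach and reflexivity would provide
  $z \in \mathcal{N}_M(q)$ with $s z(x_0) < 0$, whereas $z \in \mathcal{N}_M(q)$ forces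
  $q z = |z|$ a.e. and therefore $s z \ge 0$ on $\{s y > 0\}$. As $-s\delta_{x_0}$ vanishes at $y$ but not at
  $\varphi$, polyhedricity fails.\<close>

section \<open>Hahn--Banach separation from a convex cone\<close>

definition sublinear :: "('a::real_vector \<Rightarrow> real) \<Rightarrow> bool" where
  "sublinear p \<longleftrightarrow>
     (\<forall>x y. p (x + y) \<le> p x + p y) \<and> (\<forall>c x. c \<ge> 0 \<longrightarrow> p (c *\<^sub>R x) = c * p x)"

lemma sublinear_add: "sublinear p \<Longrightarrow> p (x + y) \<le> p x + p y"
  by (simp add: sublinear_def)

lemma sublinear_scale: "sublinear p \<Longrightarrow> c \<ge> 0 \<Longrightarrow> p (c *\<^sub>R x) = c * p x"
  by (simp add: sublinear_def)

lemma sublinear_0: "sublinear p \<Longrightarrow> p 0 = 0"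
  using sublinear_scale[of p 0 0] by simp

lemma sublinear_minus: "sublinear p \<Longrightarrow> - p (- x) \<le> p x"
  using sublinear_add[of p x "- x"] by (simp add: sublinear_0)

text \<open>An inequality suffices for homogeneity: applied to \<open>inverse c\<close> and
  \<open>c *\<^sub>R x\<close> it gives the reverse one. The scalar 0 is outside its range and is
  covered by \<open>zero\<close>.\<close>

lemma sublinearI:
  assumes add: "\<And>x y. p (x + y) \<le> p x + p y" and zero: "p 0 = 0"
    and scale: "\<And>c x. c > 0 \<Longrightarrow> p (c *\<^sub>R x) \<le> c * p x"
  shows "sublinear p"
  unfolding sublinear_def
proof (intro conjI allI impI add)
  fix c :: real and x assume "c \<ge> 0"
  show "p (c *\<^sub>R x) = c * p x"
  proof (cases "c = 0")
    case False
    then have c: "c > 0" using \<open>c \<ge> 0\<close> by simp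
    have "p (inverse c *\<^sub>R (c *\<^sub>R x)) \<le> inverse c * p (c *\<^sub>R x)"
      using scale[of "inverse c" "c *\<^sub>R x"] c by simp
    then have "c * p x \<le> p (c *\<^sub>R x)"
      using c by (simp add: field_simps)
    then show ?thesis using scale[OF c, of x] by simp
  qed (simp add: zero)
qed

text \<open>A pointwise minimal sublinear functional is fixed by this operation,
  which forces \<open>p x + p a \<le> p (x + a)\<close>, hence linearity.\<close>

definition lower_along :: "('a::real_vector \<Rightarrow> real) \<Rightarrow> 'a \<Rightarrow> 'a \<Rightarrow> real" where
  "lower_along p a x = (INF t\<in>{0..}. p (x + t *\<^sub>R a) - t * p a)"

text \<open>The content is that the infimum is over a set bounded below:
  \<open>t * p a = p (t *\<^sub>R a)\<close>, and subadditivity bounds every candidate from below by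
  \<open>- p (- x)\<close>.\<close>

lemma lower_along_le:
  assumes p: "sublinear p" and t: "t \<ge> 0"
  shows "lower_along p a x \<le> p (x + t *\<^sub>R a) - t * p a"
  unfolding lower_along_def
proof (rule cINF_lower)
  show "bdd_below ((\<lambda>t. p (x + t *\<^sub>R a) - t * p a) ` {0..})"
  proof (rule bdd_belowI2)
    fix s :: real assume "s \<in> {0..}"
    then have "s * p a = p (s *\<^sub>R a)" using sublinear_scale[OF p] by simp
    moreover have "p (s *\<^sub>R a) \<le> p (x + s *\<^sub>R a) + p (- x)"
      using sublinear_add[OF p, of "x + s *\<^sub>R a" "- x"] by simp
    ultimately show "- p (- x) \<le> p (x + s *\<^sub>R a) - s * p a" by simp
  qed
qed (use t in simp)

lemma lower_along_ge:
  assumes "\<And>t. t \<ge> 0 \<Longrightarrow> c \<le> p (x + t *\<^sub>R a) - t * p a"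
  shows "c \<le> lower_along p a x"
  unfolding lower_along_def by (rule cINF_greatest) (use assms in auto)

lemma lower_along_le_self: "sublinear p \<Longrightarrow> lower_along p a x \<le> p x"
  using lower_along_le[of p 0 a x] by simp

text \<open>Parameters \<open>t\<close> for \<open>x\<close> and \<open>s\<close> for
  \<open>y\<close> combine to \<open>t + s\<close> for \<open>x + y\<close>. For a scalar
  \<open>c > 0\<close> the parameter is rescaled from \<open>t\<close> to
  \<open>c * t\<close>.\<close>

lemma sublinear_lower_along:
  assumes p: "sublinear p"
  shows "sublinear (lower_along p a)"
proof (rule sublinearI)
  fix x y
  have le: "lower_along p a (x + y) \<le> (p (x + t *\<^sub>R a) - t * p a) + (p (y + s *\<^sub>R a) - s * p a)"
    if "t \<ge> 0" "s \<ge> 0" for t s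
    using lower_along_le[OF p, of "t + s" a "x + y"] that
      sublinear_add[OF p, of "x + t *\<^sub>R a" "y + s *\<^sub>R a"]
    by (simp add: algebra_simps)
  have "lower_along p a (x + y) - (p (x + t *\<^sub>R a) - t * p a) \<le> lower_along p a y"
    if "t \<ge> 0" for t
    by (rule lower_along_ge) (use le[OF that] in \<open>simp add: algebra_simps\<close>)
  then have "lower_along p a (x + y) - lower_along p a y \<le> lower_along p a x"
    by (intro lower_along_ge) (simp add: algebra_simps)
  then show "lower_along p a (x + y) \<le> lower_along p a x + lower_along p a y" by simp
next
  show "lower_along p a 0 = 0"
  proof (rule antisym)
    show "lower_along p a 0 \<le> 0"
      using lower_along_le_self[OF p, of a 0] sublinear_0[OF p] by simp
    show "0 \<le> lower_along p a 0"
      by (rule lower_along_ge) (use sublinear_scale[OF p] in simp)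
  qed
next
  fix c :: real and x assume c: "c > 0"
  have "lower_along p a (c *\<^sub>R x) / c \<le> lower_along p a x"
  proof (rule lower_along_ge)
    fix t :: real assume t: "t \<ge> 0"
    have "lower_along p a (c *\<^sub>R x) \<le> p (c *\<^sub>R x + (c * t) *\<^sub>R a) - c * t * p a"
      by (rule lower_along_le[OF p]) (use c t in simp)
    also have "p (c *\<^sub>R x + (c * t) *\<^sub>R a) = c * p (x + t *\<^sub>R a)"
      using sublinear_scale[OF p, of c "x + t *\<^sub>R a"] c by (simp add: scaleR_add_right)
    finally show "lower_along p a (c *\<^sub>R x) / c \<le> p (x + t *\<^sub>R a) - t * p a"
      using c by (simp add: field_simps)
  qed
  then show "lower_along p a (c *\<^sub>R x) \<le> c * lower_along p a x"
    using c by (simp add: field_simps)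
qed

section \<open>Minimal sublinear functionals and linear minorants\<close>

text \<open>Supplies the lower bounds for Zorn's lemma. The common majorant \<open>p\<close> keeps
  the infima finite, since every member is at least \<open>- p (- x)\<close> at \<open>x\<close>.
  Comparability gives subadditivity: \<open>f x + g y\<close> is at least \<open>h x + h y\<close>
  for the smaller \<open>h\<close> of the two.\<close>

lemma sublinear_chain_Inf:
  assumes ne: "C \<noteq> {}" and sub: "\<And>f. f \<in> C \<Longrightarrow> sublinear f" and le: "\<And>f. f \<in> C \<Longrightarrow> f \<le> p"
    and chain: "\<And>f g. f \<in> C \<Longrightarrow> g \<in> C \<Longrightarrow> f \<le> g \<or> g \<le> f"
  shows "sublinear (\<lambda>x. INF f\<in>C. f x)" and "\<And>f x. f \<in> C \<Longrightarrow> (INF f\<in>C. f x) \<le> f x"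
proof -
  show low: "(INF f\<in>C. f x) \<le> f x" if "f \<in> C" for f x
  proof (rule cINF_lower[OF _ that], rule bdd_belowI2)
    fix g assume "g \<in> C"
    then have "g (- x) \<le> p (- x)" "- g (- x) \<le> g x"
      using le[of g] sublinear_minus[OF sub, of g x] by (auto simp: le_fun_def)
    then show "- p (- x) \<le> g x" by simp
  qed
  show "sublinear (\<lambda>x. INF f\<in>C. f x)"
  proof (rule sublinearI)
    fix x y
    have *: "(INF f\<in>C. f (x + y)) \<le> f x + g y" if fg: "f \<in> C" "g \<in> C" for f g
    proof -
      obtain h where h: "h \<in> C" "h \<le> f" "h \<le> g"
        using chain[OF fg] fg order_refl by metis
      have "(INF f\<in>C. f (x + y)) \<le> h x + h y"
        using low[OF h(1), of "x + y"] sublinear_add[OF sub[OF h(1)], of x y] by simp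
      then show ?thesis using h(2,3) by (meson add_mono le_funD order_trans)
    qed
    have "(INF f\<in>C. f (x + y)) - f x \<le> (INF f\<in>C. f y)" if "f \<in> C" for f
      by (rule cINF_greatest[OF ne]) (use *[OF that] in \<open>simp add: algebra_simps\<close>)
    then have "(INF f\<in>C. f (x + y)) - (INF f\<in>C. f y) \<le> (INF f\<in>C. f x)"
      by (intro cINF_greatest[OF ne]) (simp add: algebra_simps)
    then show "(INF f\<in>C. f (x + y)) \<le> (INF f\<in>C. f x) + (INF f\<in>C. f y)" by simp
  next
    have "(\<lambda>f. f 0) ` C = {0}" using ne sublinear_0[OF sub] by (force simp: image_iff)
    then show "(INF f\<in>C. f 0) = 0" by simp
  next
    fix c :: real and x assume c: "c > 0"
    have "(INF f\<in>C. f (c *\<^sub>R x)) / c \<le> (INF f\<in>C. f x)"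
    proof (rule cINF_greatest[OF ne])
      fix f assume "f \<in> C"
      then show "(INF f\<in>C. f (c *\<^sub>R x)) / c \<le> f x"
        using low[of f "c *\<^sub>R x"] sublinear_scale[OF sub, of f c x] c by (simp add: field_simps)
    qed
    then show "(INF f\<in>C. f (c *\<^sub>R x)) \<le> c * (INF f\<in>C. f x)" using c by (simp add: field_simps)
  qed
qed

text \<open>A minimal sublinear functional below \<open>p\<close> is additive by
  \<open>lower_along\<close>, hence odd, and oddness extends homogeneity to negative
  scalars.\<close>

theorem Hahn_Banach_sublinear:
  assumes p: "sublinear (p :: 'a::real_vector \<Rightarrow> real)"
  obtains f where "linear f" "\<And>x. f x \<le> p x"
proof -
  define A where "A = {f. sublinear f \<and> f \<le> p}"
  \<comment> \<open>Zorn's lemma yields maximal elements, so the order is reversed to obtain a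
    pointwise minimal functional.\<close>
  let ?P = "\<lambda>f g :: 'a \<Rightarrow> real. g \<le> f"
  have "\<exists>m\<in>A. \<forall>a\<in>A. ?P m a \<longrightarrow> a = m"
  proof (rule predicate_Zorn)
    show "partial_order_on A (relation_of ?P A)"
      by (rule partial_order_on_relation_ofI) auto
    fix C assume C: "C \<in> Chains (relation_of ?P A)"
    then have CA: "C \<subseteq> A" and chain: "\<And>f g. f \<in> C \<Longrightarrow> g \<in> C \<Longrightarrow> f \<le> g \<or> g \<le> f"
      by (auto simp: Chains_def relation_of_def)
    show "\<exists>u\<in>A. \<forall>a\<in>C. u \<le> a"
    \<comment> \<open>The pointwise infimum over the empty chain carries no information;
      \<open>p\<close> itself is the bound there.\<close>
    proof (cases "C = {}")
      case True
      then show ?thesis using p by (auto simp: A_def)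
    next
      case False
      then obtain g where g: "g \<in> C" by auto
      have sub: "\<And>f. f \<in> C \<Longrightarrow> sublinear f" and le: "\<And>f. f \<in> C \<Longrightarrow> f \<le> p"
        using CA by (auto simp: A_def)
      have inf: "sublinear (\<lambda>x. INF f\<in>C. f x)"
        by (rule sublinear_chain_Inf(1)[where p = p, OF False]) (fact sub le chain)+
      have inf_le: "(INF f\<in>C. f x) \<le> f x" if "f \<in> C" for f x
        by (rule sublinear_chain_Inf(2)[where p = p, OF False _ _ _ that]) (fact sub le chain)+
      have "(\<lambda>x. INF f\<in>C. f x) \<le> p"
        using order_trans[OF le_funI[of "\<lambda>x. INF f\<in>C. f x" g, OF inf_le[OF g]] le[OF g]] .
      with inf have "(\<lambda>x. INF f\<in>C. f x) \<in> A" by (simp add: A_def)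
      moreover have "\<forall>f\<in>C. (\<lambda>x. INF f\<in>C. f x) \<le> f" by (intro ballI le_funI inf_le)
      ultimately show ?thesis by blast
    qed
  qed
  then obtain m where "m \<in> A" and mA: "\<forall>a\<in>A. a \<le> m \<longrightarrow> a = m" by blast
  then have m: "sublinear m" "m \<le> p" by (simp_all add: A_def)
  have min: "f = m" if "sublinear f" "f \<le> m" for f
    using mA that order_trans[OF that(2) m(2)] by (simp add: A_def)
  have add: "m (x + a) = m x + m a" for x a
  proof (rule antisym)
    have "lower_along m a = m"
      by (rule min) (auto simp: le_fun_def sublinear_lower_along lower_along_le_self m)
    then show "m x + m a \<le> m (x + a)"
      using lower_along_le[OF m(1), of 1 a x] by simp
  qed (rule sublinear_add[OF m(1)])
  have neg: "m (- x) = - m x" for x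
    using add[of x "- x"] sublinear_0[OF m(1)] by simp
  have "m (c *\<^sub>R x) = c * m x" for c x
  proof (cases "c \<ge> 0")
    case False
    then show ?thesis using sublinear_scale[OF m(1), of "- c" x] neg[of "c *\<^sub>R x"] by simp
  qed (simp add: sublinear_scale[OF m(1)])
  then have "linear m" by (intro linearI) (auto simp: add)
  with that m(2) show thesis by (auto simp: le_fun_def)
qed

section \<open>Separation through the distance to a cone\<close>

text \<open>Sums and positive multiples of almost nearest points stay in a convex cone, so they
  compete in the infimum for \<open>x + y\<close> and \<open>c *\<^sub>R x\<close>.\<close>

lemma sublinear_infdist_cone:
  fixes K :: "'a::real_normed_vector set"
  assumes K: "convex K" "cone K" "K \<noteq> {}"
  shows "sublinear (\<lambda>x. infdist x K)"
proof (rule sublinearI)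
  have approx: "\<exists>k\<in>K. dist x k < infdist x K + e" if "e > 0" for x and e :: real
    using cINF_less_iff[of K "dist x" "infdist x K + e"] K(3) that by (simp add: infdist_notempty)
  fix x y :: 'a
  show "infdist (x + y) K \<le> infdist x K + infdist y K"
  proof (rule field_le_epsilon)
    fix e :: real assume "e > 0"
    then obtain k l where kl: "k \<in> K" "l \<in> K" "dist x k < infdist x K + e / 2"
        "dist y l < infdist y K + e / 2"
      using approx[of "e / 2"] by (meson half_gt_zero)
    have "k + l \<in> K" using K(1,2) kl(1,2) convex_cone by blast
    then have "infdist (x + y) K \<le> dist (x + y) (k + l)" by (rule infdist_le)
    also have "\<dots> \<le> dist x k + dist y l" by (rule dist_triangle_add)
    finally show "infdist (x + y) K \<le> infdist x K + infdist y K + e" using kl by simp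
  qed
next
  show "infdist 0 K = 0"
    using K(2,3) by (simp add: cone_contains_0 infdist_zero)
next
  fix c :: real and x :: 'a assume c: "c > 0"
  have "infdist (c *\<^sub>R x) K / c \<le> infdist x K"
    unfolding infdist_notempty[OF K(3), of x]
  proof (rule cINF_greatest[OF K(3)])
    fix k assume "k \<in> K"
    then have "infdist (c *\<^sub>R x) K \<le> dist (c *\<^sub>R x) (c *\<^sub>R k)"
      using K(2) c by (intro infdist_le) (auto simp: cone_def)
    also have "\<dots> = c * dist x k"
      using c by (simp add: dist_norm flip: scaleR_diff_right)
    finally show "infdist (c *\<^sub>R x) K / c \<le> dist x k" using c by (simp add: field_simps)
  qed
  then show "infdist (c *\<^sub>R x) K \<le> c * infdist x K" using c by (simp add: field_simps)
qed

text \<open>The distance \<open>p\<close> to \<open>K\<close> vanishes on \<open>K\<close>, so a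
  linear \<open>f\<close> below it is nonpositive there; \<open>p x \<le> norm x\<close> makes
  \<open>f\<close> bounded.\<close>

theorem separate_point_convex_cone:
  fixes K :: "'a::real_normed_vector set"
  assumes K: "convex K" "cone K" "K \<noteq> {}" and w: "w \<notin> closure K"
  shows "\<exists>f :: 'a \<Rightarrow>\<^sub>L real. (\<forall>h\<in>K. blinfun_apply f h \<le> 0) \<and> blinfun_apply f w > 0"
proof -
  define p where "p = (\<lambda>x. infdist x K)"
  have p: "sublinear p" unfolding p_def by (rule sublinear_infdist_cone[OF K])
  have pw: "p w > 0"
    using w in_closure_iff_infdist_zero[OF K(3), of w] infdist_nonneg[of w K]
    by (simp add: p_def)
  \<comment> \<open>Taking a minorant of \<open>lower_along p w\<close> rather than of
    \<open>p\<close> forces positivity at \<open>w\<close>: the parameter 1 at \<open>- w\<close>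
    gives \<open>f (- w) \<le> p 0 - p w = - p w\<close>.\<close>
  obtain f where f: "linear f" and fle: "\<And>x. f x \<le> lower_along p w x"
    using Hahn_Banach_sublinear[OF sublinear_lower_along[OF p]] by blast
  have fp: "f x \<le> p x" for x using fle lower_along_le_self[OF p] order_trans by blast
  have "f (- w) \<le> - p w"
    using order_trans[OF fle[of "- w"] lower_along_le[OF p, of 1 w "- w"]] sublinear_0[OF p] by simp
  then have fw: "f w > 0" using pw linear_neg[OF f, of w] by simp
  have "f x \<le> norm x" for x
  proof -
    have "0 \<in> K" using K(2,3) by (simp add: cone_contains_0)
    then have "p x \<le> dist x 0" unfolding p_def by (rule infdist_le)
    then show ?thesis using fp[of x] by simp
  qed
  then have "norm (f x) \<le> norm x * 1" for x
    using linear_neg[OF f, of x] by (smt (verit) norm_minus_cancel real_norm_def mult_1_right)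
  then have bl: "bounded_linear f"
    by (rule bounded_linear_intro[OF linear_add[OF f] linear_cmul[OF f]])
  show ?thesis
  proof (intro exI[of _ "Blinfun f"] conjI ballI)
    show "blinfun_apply (Blinfun f) h \<le> 0" if "h \<in> K" for h
      using fp[of h] infdist_zero[OF that] by (simp add: p_def bounded_linear_Blinfun_apply[OF bl])
    show "blinfun_apply (Blinfun f) w > 0" using fw by (simp add: bounded_linear_Blinfun_apply[OF bl])
  qed
qed

section \<open>Radial and tangent cones\<close>

lemma radial_coneI: "k \<in> K \<Longrightarrow> k - w \<in> radial_cone K w"
  unfolding radial_cone_def by (rule CollectI, rule exI[of _ 1]) auto

text \<open>The factors in \<open>radial_cone\<close> are strictly positive; the zero vector enters
  through \<open>k = w\<close>, hence the assumption on \<open>w\<close>.\<close>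

lemma cone_radial_cone:
  assumes "w \<in> K" shows "cone (radial_cone K w)"
  unfolding cone_def
proof (intro ballI allI impI)
  fix h and c :: real assume h: "h \<in> radial_cone K w" and c: "0 \<le> c"
  show "c *\<^sub>R h \<in> radial_cone K w"
  proof (cases "c = 0")
    case True
    then show ?thesis using radial_coneI[OF assms, of w] by simp
  next
    case False
    with h c show ?thesis
      by (force simp: radial_cone_def intro: mult_pos_pos)
  qed
qed

text \<open>A sum of directions with factors \<open>s\<close> and \<open>t\<close> is
  \<open>s + t\<close> times the direction to the convex combination with weights
  \<open>s / (s + t)\<close> and \<open>t / (s + t)\<close>.\<close>

lemma convex_radial_cone:
  assumes K: "convex K" and w: "w \<in> K" shows "convex (radial_cone K w)"
proof -
  have "g + h \<in> radial_cone K w" if gh: "g \<in> radial_cone K w" "h \<in> radial_cone K w" for g h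
  proof -
    obtain s k t l where s: "s > 0" "k \<in> K" "g = s *\<^sub>R (k - w)"
      and t: "t > 0" "l \<in> K" "h = t *\<^sub>R (l - w)"
      using gh unfolding radial_cone_def by blast
    have "(s / (s + t)) *\<^sub>R k + (t / (s + t)) *\<^sub>R l \<in> K"
      using s t by (intro convexD[OF K]) (auto simp: add_divide_distrib[symmetric])
    moreover have "g + h = (s + t) *\<^sub>R ((s / (s + t)) *\<^sub>R k + (t / (s + t)) *\<^sub>R l - w)"
      using s t by (simp add: scaleR_add_right scaleR_diff_right scaleR_add_left)
    ultimately show ?thesis using s t unfolding radial_cone_def
      by (intro CollectI exI[of _ "s + t"] exI conjI) (auto intro: add_pos_pos)
  qed
  then show ?thesis
    using convex_cone[of "radial_cone K w"] cone_radial_cone[OF w] by (auto simp: cone_def)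
qed

text \<open>A bipolar argument. A direction outside the closed cone is separated from it by an
  element of the bidual; reflexivity turns this into evaluation at some \<open>z\<close>, so testing
  against normals taken from the predual is enough.\<close>

lemma in_tangent_cone_reflexive:
  fixes K :: "('v::banach \<Rightarrow>\<^sub>L real) set"
  assumes refl: "reflexive_space TYPE('v)" and K: "convex K" "w \<in> K"
    and polar: "\<And>z. (\<And>k. k \<in> K \<Longrightarrow> blinfun_apply k z \<le> blinfun_apply w z) \<Longrightarrow> blinfun_apply h z \<le> 0"
  shows "h \<in> tangent_cone K w"
proof (rule ccontr)
  assume "h \<notin> tangent_cone K w"
  then have h: "h \<notin> closure (radial_cone K w)" by (simp add: tangent_cone_def)
  have "radial_cone K w \<noteq> {}" using radial_coneI[OF K(2)] by blast
  then obtain f :: "('v \<Rightarrow>\<^sub>L real) \<Rightarrow>\<^sub>L real" where f: "\<And>g. g \<in> radial_cone K w \<Longrightarrow> blinfun_apply f g \<le> 0"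
      "blinfun_apply f h > 0"
    using separate_point_convex_cone[OF convex_radial_cone[OF K] cone_radial_cone[OF K(2)] _ h]
    by blast
  obtain z where z: "f = bidual_embedding z"
    using refl unfolding reflexive_space_def by (metis surjD)
  have "blinfun_apply k z \<le> blinfun_apply w z" if "k \<in> K" for k
    using f(1)[OF radial_coneI[OF that]] by (simp add: z blinfun.diff_left)
  then show False using polar f(2) by (force simp: z)
qed

section \<open>The box and its normals\<close>

text \<open>Point evaluation has norm at most 1 for the supremum norm; composed with
  \<open>J\<close> it yields the Dirac functionals in the dual of V.\<close>

lemma bounded_linear_apply_bcontfun:
  fixes x :: "'x::topological_space"
  shows "bounded_linear (\<lambda>f :: 'x \<Rightarrow>\<^sub>C 'b::real_normed_vector. apply_bcontfun f x)"
  by (rule bounded_linear_intro[where K = 1])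
    (simp_all add: plus_bcontfun.rep_eq scaleR_bcontfun.rep_eq norm_bounded)

lemma integrable_mult_box:
  fixes v f :: "'x \<Rightarrow> real"
  assumes f: "integrable M f" and v: "v \<in> borel_measurable M" "AE x in M. \<bar>v x\<bar> \<le> 1"
  shows "integrable M (\<lambda>x. v x * f x)"
  by (rule Bochner_Integration.integrable_bound[OF f])
    (use v f in \<open>auto simp: abs_mult intro: mult_left_le_one_le elim!: eventually_mono\<close>)

text \<open>The functional given by \<open>v\<close> is bounded because its value at
  \<open>u\<close> is at most the L1 norm of \<open>J u\<close>, which the embedding bounds by
  \<open>C * norm u\<close>.\<close>

lemma box_setI:
  assumes J: "embeds_densely_L1 \<mu> J"
    and v: "v \<in> borel_measurable \<mu>" "AE x in \<mu>. \<bar>v x\<bar> \<le> 1"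
  obtains k where "k \<in> box_set \<mu> J" "represents \<mu> J v k"
proof -
  have int: "integrable \<mu> (apply_bcontfun (J u))" for u
    using J by (simp add: embeds_densely_L1_def)
  obtain C where C: "\<And>u. (\<integral>x. \<bar>apply_bcontfun (J u) x\<bar> \<partial>\<mu>) \<le> C * norm u"
    using J by (auto simp: embeds_densely_L1_def)
  have lin: "linear J" using J by (simp add: embeds_densely_L1_def)
  note vint = integrable_mult_box[OF int v]
  have "bounded_linear (\<lambda>u. \<integral>x. v x * apply_bcontfun (J u) x \<partial>\<mu>)"
  proof (rule bounded_linear_intro)
    fix a b :: 'b and r :: real
    show "(\<integral>x. v x * apply_bcontfun (J (a + b)) x \<partial>\<mu>) =
        (\<integral>x. v x * apply_bcontfun (J a) x \<partial>\<mu>) + (\<integral>x. v x * apply_bcontfun (J b) x \<partial>\<mu>)"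
      using vint by (simp add: linear_add[OF lin] plus_bcontfun.rep_eq distrib_left)
    show "(\<integral>x. v x * apply_bcontfun (J (r *\<^sub>R a)) x \<partial>\<mu>) =
        r *\<^sub>R (\<integral>x. v x * apply_bcontfun (J a) x \<partial>\<mu>)"
      by (simp add: linear_cmul[OF lin] scaleR_bcontfun.rep_eq mult.left_commute)
    have "norm (\<integral>x. v x * apply_bcontfun (J a) x \<partial>\<mu>) \<le> (\<integral>x. norm (v x * apply_bcontfun (J a) x) \<partial>\<mu>)"
      by (rule integral_norm_bound)
    also have "\<dots> \<le> (\<integral>x. \<bar>apply_bcontfun (J a) x\<bar> \<partial>\<mu>)"
      by (rule integral_mono_AE[OF integrable_norm[OF vint]])
        (use int v(2) in \<open>auto simp: abs_mult intro: mult_left_le_one_le elim!: eventually_mono\<close>)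
    finally show "norm (\<integral>x. v x * apply_bcontfun (J a) x \<partial>\<mu>) \<le> norm a * C"
      using C[of a] by (simp add: mult.commute)
  qed
  then have "represents \<mu> J v (Blinfun (\<lambda>u. \<integral>x. v x * apply_bcontfun (J u) x \<partial>\<mu>))"
    by (simp add: represents_def bounded_linear_Blinfun_apply)
  moreover have "v \<in> Linfty \<mu>" using v by (auto simp: Linfty_def)
  moreover have "AE x in \<mu>. -1 \<le> v x \<and> v x \<le> 1" using v(2) by eventually_elim (simp add: abs_le_iff)
  ultimately show thesis using that unfolding box_set_def by blast
qed

lemma box_setE:
  assumes "k \<in> box_set \<mu> J"
  obtains v where "v \<in> borel_measurable \<mu>" "AE x in \<mu>. \<bar>v x\<bar> \<le> 1" "represents \<mu> J v k"
proof -
  obtain v where v: "v \<in> Linfty \<mu>" "AE x in \<mu>. -1 \<le> v x \<and> v x \<le> 1" "represents \<mu> J v k"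
    using assms by (auto simp: box_set_def)
  have "AE x in \<mu>. \<bar>v x\<bar> \<le> 1" using v(2) by eventually_elim auto
  with v that show thesis by (auto simp: Linfty_def)
qed

lemma convex_box_set:
  assumes J: "embeds_densely_L1 \<mu> J"
  shows "convex (box_set \<mu> J)"
proof (rule convexI)
  fix k l and a b :: real
  assume kl: "k \<in> box_set \<mu> J" "l \<in> box_set \<mu> J" and ab: "0 \<le> a" "0 \<le> b" "a + b = 1"
  obtain v where v: "v \<in> borel_measurable \<mu>" "AE x in \<mu>. \<bar>v x\<bar> \<le> 1" "represents \<mu> J v k"
    using kl(1) by (rule box_setE)
  obtain w where w: "w \<in> borel_measurable \<mu>" "AE x in \<mu>. \<bar>w x\<bar> \<le> 1" "represents \<mu> J w l"
    using kl(2) by (rule box_setE)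
  have int: "integrable \<mu> (apply_bcontfun (J u))" for u
    using J by (simp add: embeds_densely_L1_def)
  have "AE x in \<mu>. \<bar>a * v x + b * w x\<bar> \<le> 1"
    using v(2) w(2)
  proof eventually_elim
    case (elim x)
    then show ?case
      using convexD[OF convex_real_interval(5)[of "-1" 1], of "v x" "w x" a b] ab
      by (auto simp: abs_le_iff)
  qed
  then obtain m where m: "m \<in> box_set \<mu> J" "represents \<mu> J (\<lambda>x. a * v x + b * w x) m"
    using box_setI[OF J, of "\<lambda>x. a * v x + b * w x"] v w by auto
  have "m = a *\<^sub>R k + b *\<^sub>R l"
  proof (rule blinfun_eqI)
    fix u
    show "blinfun_apply m u = blinfun_apply (a *\<^sub>R k + b *\<^sub>R l) u"
      using m(2) v(3) w(3) integrable_mult_box[OF int v(1,2), of u]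
        integrable_mult_box[OF int w(1,2), of u]
      by (simp add: represents_def blinfun.add_left blinfun.scaleR_left distrib_right mult.assoc)
  qed
  with m show "a *\<^sub>R k + b *\<^sub>R l \<in> box_set \<mu> J" by simp
qed

text \<open>Here \<open>max\<close> is normality of \<open>y\<close> at \<open>q\<close>. Testing it
  with the sign of \<open>y\<close> shows that the integral of \<open>v y\<close> is at least that
  of \<open>|y|\<close>, while \<open>v y \<le> |y|\<close> a.e.; the nonnegative difference has
  integral zero.\<close>

lemma box_set_normal_saturated:
  fixes J :: "'v::real_normed_vector \<Rightarrow> ('x::topological_space \<Rightarrow>\<^sub>C real)"
  assumes J: "embeds_densely_L1 \<mu> J"
    and v: "v \<in> borel_measurable \<mu>" "AE x in \<mu>. \<bar>v x\<bar> \<le> 1" "represents \<mu> J v q"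
    and max: "\<And>k. k \<in> box_set \<mu> J \<Longrightarrow> blinfun_apply k y \<le> blinfun_apply q y"
  shows "AE x in \<mu>. v x * apply_bcontfun (J y) x = \<bar>apply_bcontfun (J y) x\<bar>"
proof -
  let ?y = "apply_bcontfun (J y)"
  have int: "integrable \<mu> ?y" using J by (simp add: embeds_densely_L1_def)
  have vint: "integrable \<mu> (\<lambda>x. v x * ?y x)" by (rule integrable_mult_box[OF int v(1,2)])
  obtain k where k: "k \<in> box_set \<mu> J" "represents \<mu> J (\<lambda>x. sgn (?y x)) k"
    by (rule box_setI[OF J, of "\<lambda>x. sgn (?y x)"]) (use int in \<open>auto simp: sgn_real_def\<close>)
  have "(\<integral>x. \<bar>?y x\<bar> \<partial>\<mu>) \<le> (\<integral>x. v x * ?y x \<partial>\<mu>)"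
    using max[OF k(1)] k(2) v(3) by (simp add: represents_def mult_sgn_abs mult.commute flip: abs_sgn)
  then have "(\<integral>x. \<bar>?y x\<bar> - v x * ?y x \<partial>\<mu>) \<le> 0"
    using int vint by simp
  moreover have nn: "AE x in \<mu>. 0 \<le> \<bar>?y x\<bar> - v x * ?y x"
    using v(2)
  proof eventually_elim
    case (elim x)
    have "v x * ?y x \<le> \<bar>v x\<bar> * \<bar>?y x\<bar>" by (metis abs_ge_self abs_mult)
    also have "\<dots> \<le> \<bar>?y x\<bar>" using elim by (simp add: mult_left_le_one_le)
    finally show ?case by simp
  qed
  ultimately have "(\<integral>x. \<bar>?y x\<bar> - v x * ?y x \<partial>\<mu>) = 0"
    using integral_nonneg_AE[OF nn] by simp
  then have "AE x in \<mu>. \<bar>?y x\<bar> - v x * ?y x = 0"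
    using integral_nonneg_eq_0_iff_AE[OF _ nn] int vint by simp
  then show ?thesis by eventually_elim simp
qed

text \<open>If \<open>s z\<close> were negative at \<open>x\<close>, it would be so on an open
  \<open>W\<close> meeting \<open>B\<close> in a set of positive measure. Saturation gives
  \<open>s z = v z = |z|\<close> a.e. on that set, a contradiction. Continuity of \<open>z\<close>
  is what reaches points of the closure, where \<open>v\<close> is not controlled.\<close>

lemma box_set_normal_sign:
  fixes J :: "'v::real_normed_vector \<Rightarrow> ('x::metric_space \<Rightarrow>\<^sub>C real)" and s :: real
  assumes J: "embeds_densely_L1 \<mu> J" and sets: "sets \<mu> = sets borel"
    and pos: "\<And>A. open A \<Longrightarrow> A \<noteq> {} \<Longrightarrow> emeasure \<mu> A > 0"
    and v: "v \<in> borel_measurable \<mu>" "AE x in \<mu>. \<bar>v x\<bar> \<le> 1" "represents \<mu> J v q"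
    and max: "\<And>k. k \<in> box_set \<mu> J \<Longrightarrow> blinfun_apply k z \<le> blinfun_apply q z"
    and B: "open B" "AE x in \<mu>. x \<in> B \<longrightarrow> v x = s" and s: "\<bar>s\<bar> = 1"
    and x: "x \<in> closure B"
  shows "0 \<le> s * apply_bcontfun (J z) x"
proof (rule ccontr)
  let ?z = "apply_bcontfun (J z)"
  assume neg: "\<not> 0 \<le> s * ?z x"
  have cont: "continuous_on UNIV ?z" by (rule continuous_on_apply_bcontfun)
  define W where "W = {x. s * ?z x < 0}"
  have W: "open W" unfolding W_def by (intro open_Collect_less continuous_intros cont)
  have xW: "x \<in> W" using neg by (simp add: W_def)
  have "W \<inter> B \<noteq> {}"
    using x xW open_Int_closure_eq_empty[OF W, of B] by blast
  then have p: "emeasure \<mu> (W \<inter> B) > 0" using pos W B by blast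
  have "AE x in \<mu>. v x * ?z x = \<bar>?z x\<bar>" by (rule box_set_normal_saturated[OF J v max])
  with B(2) have "AE x in \<mu>. x \<notin> W \<inter> B"
    by eventually_elim (auto simp: W_def)
  moreover have "W \<inter> B \<in> sets \<mu>" using W B sets by auto
  ultimately have "emeasure \<mu> (W \<inter> B) = 0"
    by (subst (asm) AE_iff_measurable[of "W \<inter> B"]) (use sets sets_eq_imp_space_eq[OF sets] in auto)
  with p show False by simp
qed

section \<open>Failure of polyhedricity\<close>

theorem theorem3p4:
  fixes \<mu> :: "'x::metric_space measure"
    and J :: "'v::banach \<Rightarrow> ('x \<Rightarrow>\<^sub>C real)"
    and q :: "'v \<Rightarrow>\<^sub>L real" and y :: 'v and U :: "'x set"
  assumes "locally_compact_space (euclidean :: 'x topology)"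
    and "separable_space (euclidean :: 'x topology)"
    and "sets \<mu> = sets borel"
    and "\<And>A. open A \<Longrightarrow> A \<noteq> {} \<Longrightarrow> emeasure \<mu> A > 0"
    and "\<And>K. compact K \<Longrightarrow> emeasure \<mu> K < \<infinity>"
    and "reflexive_space TYPE('v)"
    and "embeds_densely_L1 \<mu> J"
    and "embeds_Cb J"
    and "q \<in> box_set \<mu> J"
    and "bidual_embedding y \<in> normal_cone (box_set \<mu> J) q"
    and "open U"
    and "emeasure \<mu> (U \<inter> {x. apply_bcontfun (J y) x = 0}) = 0"
    and "U \<inter> {x. apply_bcontfun (J y) x = 0} \<noteq> {}"
    and "\<And>x. x \<in> U \<Longrightarrow> \<exists>\<phi>::'v. apply_bcontfun (J \<phi>) x = 1 \<and>
           (\<forall>z. z \<notin> U \<longrightarrow> apply_bcontfun (J \<phi>) z = 0)"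
  shows "\<not> polyhedric_at (box_set \<mu> J) q (bidual_embedding y)"
proof -
  note sets = assms(3) and pos = assms(4) and J = assms(7) and qM = assms(9) and U = assms(11)
  let ?M = "box_set \<mu> J" and ?y = "apply_bcontfun (J y)"
  have space: "space \<mu> = UNIV" using sets_eq_imp_space_eq[OF sets] by simp
  have cont: "continuous_on UNIV (apply_bcontfun (J u))" for u
    by (rule continuous_on_apply_bcontfun)
  have int: "integrable \<mu> (apply_bcontfun (J u))" for u
    using J by (simp add: embeds_densely_L1_def)
  obtain v where v: "v \<in> borel_measurable \<mu>" "AE x in \<mu>. \<bar>v x\<bar> \<le> 1" "represents \<mu> J v q"
    using qM by (rule box_setE)
  \<comment> \<open>The normal cone inequality, tested with the radial direction
    \<open>k - q\<close>, says that \<open>q\<close> maximizes the pairing with \<open>y\<close>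
    over the box.\<close>
  have max: "blinfun_apply k y \<le> blinfun_apply q y" if "k \<in> ?M" for k
    using assms(10) radial_coneI[OF that, of q] closure_subset
    by (fastforce simp: normal_cone_def tangent_cone_def blinfun.diff_left)
  have sat: "AE x in \<mu>. v x * ?y x = \<bar>?y x\<bar>"
    by (rule box_set_normal_saturated[OF J v max])
  have closed0: "closed {x. ?y x = 0}" by (intro closed_Collect_eq continuous_intros cont)
  have zero_set: "U \<inter> {x. ?y x = 0} \<in> sets \<mu>"
    using borel_open[OF U] borel_closed[OF closed0] unfolding sets by (rule sets.Int)
  have nonzero: "AE x in \<mu>. x \<in> U \<longrightarrow> ?y x \<noteq> 0"
    by (subst AE_iff_measurable[OF zero_set]) (use assms(12) space in auto)
  obtain x0 where x0: "x0 \<in> U" "?y x0 = 0" using assms(13) by auto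
  obtain \<phi> where \<phi>: "apply_bcontfun (J \<phi>) x0 = 1" "\<And>z. z \<notin> U \<Longrightarrow> apply_bcontfun (J \<phi>) z = 0"
    using assms(14)[OF x0(1)] by auto
  define B where "B = (\<lambda>s. U \<inter> {x. s * ?y x > 0})"
  \<comment> \<open>Each neighbourhood of \<open>x0\<close> meets \<open>U\<close> in a set of
    positive measure, which the null set \<open>U \<inter> {y = 0}\<close> cannot cover; so points
    with \<open>y\<close> nonzero accumulate at \<open>x0\<close>. Closure commutes with the union,
    so one of the two signs can be fixed.\<close>
  have "x0 \<in> closure (B 1 \<union> B (-1))"
    unfolding closure_iff_nhds_not_empty
  proof (intro allI impI)
    fix A T assume T: "T \<subseteq> A" "open T" "x0 \<in> T"
    have "emeasure \<mu> (T \<inter> U) > 0" using pos[of "T \<inter> U"] T U x0 by blast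
    then have "\<not> T \<inter> U \<subseteq> U \<inter> {x. ?y x = 0}"
      using emeasure_mono[OF _ zero_set, of "T \<inter> U"] assms(12) by fastforce
    then show "(B 1 \<union> B (-1)) \<inter> A \<noteq> {}"
      using T(1) by (fastforce simp: B_def)
  qed
  then obtain s :: real where s: "\<bar>s\<bar> = 1" and x0B: "x0 \<in> closure (B s)"
    by (metis Un_iff abs_minus_cancel abs_one closure_Un)
  have Bopen: "open (B s)"
    unfolding B_def by (intro open_Int U open_Collect_less continuous_intros cont)
  \<comment> \<open>On \<open>B s\<close> one has \<open>|y| = s y\<close> with \<open>y\<close>
    nonzero, so \<open>y\<close> cancels from the saturation identity.\<close>
  have vB: "AE x in \<mu>. x \<in> B s \<longrightarrow> v x = s"
    using sat
  proof eventually_elim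
    case (elim x)
    have "v x * ?y x = s * ?y x" "?y x \<noteq> 0" if "x \<in> B s"
      using that elim s by (auto simp: B_def abs_if split: if_splits)
    then show ?case by (metis mult_right_cancel)
  qed
  have blJ: "bounded_linear J" using assms(8) by (simp add: embeds_Cb_def)
  \<comment> \<open>Since \<open>q = s\<close> near \<open>x0\<close> on \<open>B s\<close>, the box
    leaves room only in direction \<open>- s\<close>; this fixes the sign of the Dirac
    functional.\<close>
  have "bounded_linear (\<lambda>u. - s * apply_bcontfun (J u) x0)"
    by (intro bounded_linear_const_mult bounded_linear_compose[OF bounded_linear_apply_bcontfun blJ])
  then obtain w where w: "\<And>u. blinfun_apply w u = - s * apply_bcontfun (J u) x0"
    using bounded_linear_Blinfun_apply by metis
  have "w \<in> tangent_cone ?M q"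
  proof (rule in_tangent_cone_reflexive[OF assms(6) convex_box_set[OF J] qM])
    fix z assume "\<And>k. k \<in> ?M \<Longrightarrow> blinfun_apply k z \<le> blinfun_apply q z"
    then show "blinfun_apply w z \<le> 0"
      using box_set_normal_sign[OF J sets pos v _ Bopen vB s x0B, of z] by (simp add: w)
  qed
  moreover have "w \<in> annihilator (bidual_embedding y)" by (simp add: annihilator_def w x0)
  moreover have "w \<notin> closure (radial_cone ?M q \<inter> annihilator (bidual_embedding y))"
  proof
    assume "w \<in> closure (radial_cone ?M q \<inter> annihilator (bidual_embedding y))"
    \<comment> \<open>The kernel of evaluation at \<open>\<phi>\<close> is closed, so it is enough
      to treat radial directions before taking the closure.\<close>
    also have "\<dots> \<subseteq> {h. blinfun_apply (bidual_embedding \<phi>) h = 0}"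
    proof (rule closure_minimal)
      show "closed {h. blinfun_apply (bidual_embedding \<phi>) h = 0}"
        by (intro closed_Collect_eq continuous_intros)
      show "radial_cone ?M q \<inter> annihilator (bidual_embedding y)
          \<subseteq> {h. blinfun_apply (bidual_embedding \<phi>) h = 0}"
      proof
        fix h assume h: "h \<in> radial_cone ?M q \<inter> annihilator (bidual_embedding y)"
        then obtain t k where t: "t > 0" "k \<in> ?M" "h = t *\<^sub>R (k - q)"
          by (auto simp: radial_cone_def)
        then have "blinfun_apply k y = blinfun_apply q y"
          using h by (simp add: annihilator_def blinfun.scaleR_left blinfun.diff_left)
        \<comment> \<open>As \<open>h\<close> annihilates \<open>y\<close>, \<open>k\<close> attains
          the same maximum as \<open>q\<close>. Both are therefore saturated, and their
          representatives agree a.e. where \<open>y\<close> is nonzero, hence a.e. on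
          \<open>U\<close>; off \<open>U\<close> the factor \<open>\<phi>\<close> vanishes.\<close>
        then have maxk: "blinfun_apply l y \<le> blinfun_apply k y" if "l \<in> ?M" for l
          using max[OF that] by simp
        obtain v' where v': "v' \<in> borel_measurable \<mu>" "AE x in \<mu>. \<bar>v' x\<bar> \<le> 1" "represents \<mu> J v' k"
          using t(2) by (rule box_setE)
        have sat': "AE x in \<mu>. v' x * ?y x = \<bar>?y x\<bar>"
          by (rule box_set_normal_saturated[OF J v' maxk])
        have "AE x in \<mu>. v' x * apply_bcontfun (J \<phi>) x = v x * apply_bcontfun (J \<phi>) x"
          using sat sat' nonzero
        proof eventually_elim
          case (elim x)
          then have "x \<in> U \<Longrightarrow> v' x = v x" by (metis mult_right_cancel)
          then show ?case using \<phi>(2)[of x] by (cases "x \<in> U") auto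
        qed
        then have "(\<integral>x. v' x * apply_bcontfun (J \<phi>) x \<partial>\<mu>) = (\<integral>x. v x * apply_bcontfun (J \<phi>) x \<partial>\<mu>)"
          using integrable_mult_box[OF int v(1,2), of \<phi>] integrable_mult_box[OF int v'(1,2), of \<phi>]
          by (intro integral_cong_AE) auto
        then show "h \<in> {h. blinfun_apply (bidual_embedding \<phi>) h = 0}"
          using v(3) v'(3) t(3)
          by (simp add: represents_def blinfun.scaleR_left blinfun.diff_left)
      qed
    qed
    \<comment> \<open>The value of \<open>w\<close> at \<open>\<phi>\<close> is \<open>- s\<close>,
      which is nonzero.\<close>
    finally show False using \<phi>(1) s by (simp add: w)
  qed
  ultimately show ?thesis unfolding polyhedric_at_def by blast
qed

end
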